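(* Let $\mathbb{P}$ be a regular prime $\omega$-poset and let $Q\subseteq\mathbb{P}$ be an up-set that is a selector. If $\{C:C\text{ is a cap of }\mathbb{P}\text{ and }Q\cap C\text{ is a cluster}\}$ is coinitial (with respect to refinement) in the family of all caps of $\mathbb{P}$ (i.e. every cap of $\mathbb{P}$ is refined by a cap $C$ such that $Q\cap C$ is a cluster), then $Q^\supseteq=\{S\in\mathsf{S}\mathbb{P}:S\subseteq Q\}$ is a connected subset of the spectrum $\mathsf{S}\mathbb{P}$.
   Context: Let $(\mathbb{P},\leq)$ be a poset. A subset $S\subseteq\mathbb{P}$ refines $T\subseteq\mathbb{P}$ if for every $s\in S$ there is $t\in T$ with $s\leq t$. An up-set is a subset $U$ such that $u\in U$ and $u\leq p$ imply $p\in U$. A band of $\mathbb{P}$ is a finite subset $B\subseteq\mathbb{P}$ such that every $p\in\mathbb{P}$ is comparable to some $b\in B$. A cap of $\mathbb{P}$ is a subset refined by some band. A selector is a subset $S\subseteq\mathbb{P}$ with $S\cap C\neq\emptyset$ for every cap $C$ of $\mathbb{P}$; a minimal selector is one minimal with respect to inclusion among all selectors. The spectrum $\mathsf{S}\mathbb{P}$ is the set of all minimal selectors, with the topology generated by the subbasis consisting of the sets $p^\in=\{S\in\mathsf{S}\mathbb{P}:p\in S\}$, for $p\in\mathbb{P}$. $\mathbb{P}$ is an $\omega$-poset if every principal filter $p^\leq=\{q\in\mathbb{P}:p\leq q\}$ is finite and, for each $n\in\omega$, the number of principal filters of size $n$ is finite. $\mathbb{P}$ is prime if every element of $\mathbb{P}$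 lies in some minimal selector. For $p,q\in\mathbb{P}$ write $p\wedge q$ if there is $r\in\mathbb{P}$ with $r\leq p$ and $r\leq q$; for $A,B\subseteq\mathbb{P}$ write $A\wedge B$ if $a\wedge b$ for some $a\in A$ and $b\in B$. For $p\in\mathbb{P}$ and a cap $C$, the star of $p$ in $C$ is $Cp=\{c\in C:c\wedge p\}$. Write $p\vartriangleleft q$ if there is a cap $C$ of $\mathbb{P}$ such that $c\leq q$ for all $c\in Cp$. The poset $\mathbb{P}$ is regular if for every cap $D$ of $\mathbb{P}$ there is a cap $C$ of $\mathbb{P}$ such that for each $c\in C$ there is $d\in D$ with $c\vartriangleleft d$. A subset $D\subseteq\mathbb{P}$ is a cluster if $A\wedge B$ whenever $A\neq\emptyset\neq B$ and $A\cup B=D$. *)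

theory Defs
  imports "HOL-Analysis.Analysis"
begin

text \<open>
  A poset is given by a carrier \<open>P\<close> inside an ordered type, with the induced order.  Every notion
  below is relative to the carrier.
\<close>

definition refines :: "'a::order set \<Rightarrow> 'a set \<Rightarrow> bool" where
  "refines S T \<longleftrightarrow> (\<forall>s\<in>S. \<exists>t\<in>T. s \<le> t)"

definition up_set :: "'a::order set \<Rightarrow> 'a set \<Rightarrow> bool" where
  "up_set P U \<longleftrightarrow> U \<subseteq> P \<and> (\<forall>u\<in>U. \<forall>p\<in>P. u \<le> p \<longrightarrow> p \<in> U)"

definition band :: "'a::order set \<Rightarrow> 'a set \<Rightarrow> bool" where
  "band P B \<longleftrightarrow> finite B \<and> B \<subseteq> P \<and> (\<forall>p\<in>P. \<exists>b\<in>B. p \<le> b \<or> b \<le> p)"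

definition cap :: "'a::order set \<Rightarrow> 'a set \<Rightarrow> bool" where
  "cap P C \<longleftrightarrow> C \<subseteq> P \<and> (\<exists>B. band P B \<and> refines B C)"

definition selector :: "'a::order set \<Rightarrow> 'a set \<Rightarrow> bool" where
  "selector P S \<longleftrightarrow> S \<subseteq> P \<and> (\<forall>C. cap P C \<longrightarrow> S \<inter> C \<noteq> {})"

definition minimal_selector :: "'a::order set \<Rightarrow> 'a set \<Rightarrow> bool" where
  "minimal_selector P S \<longleftrightarrow> selector P S \<and> (\<forall>T. selector P T \<and> T \<subseteq> S \<longrightarrow> T = S)"

definition spectrum_set :: "'a::order set \<Rightarrow> 'a set set" where
  "spectrum_set P = {S. minimal_selector P S}"

definition subbasic :: "'a::order set \<Rightarrow> 'a \<Rightarrow> 'a set set" where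
  "subbasic P p = {S \<in> spectrum_set P. p \<in> S}"

text \<open>
  The whole space is the empty intersection of subbasic sets.  It is inserted explicitly, because
  the space of \<^const>\<open>topology_generated_by\<close> is only the union of the given sets, which need not
  contain an empty minimal selector (one exists if \<open>P\<close> has no caps).
\<close>

definition spectrum :: "'a::order set \<Rightarrow> 'a set topology" where
  "spectrum P = topology_generated_by (insert (spectrum_set P) (subbasic P ` P))"

lemma topspace_spectrum: "topspace (spectrum P) = spectrum_set P"
  by (auto simp: spectrum_def subbasic_def topology_generated_by_topspace)

definition principal_filter :: "'a::order set \<Rightarrow> 'a \<Rightarrow> 'a set" where
  "principal_filter P p = {q \<in> P. p \<le> q}"

definition omega_poset :: "'a::order set \<Rightarrow> bool" where
  "omega_poset P \<longleftrightarrow>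
     (\<forall>p\<in>P. finite (principal_filter P p)) \<and>
     (\<forall>n. finite {F \<in> principal_filter P ` P. card F = n})"

definition prime_poset :: "'a::order set \<Rightarrow> bool" where
  "prime_poset P \<longleftrightarrow> (\<forall>p\<in>P. \<exists>S. minimal_selector P S \<and> p \<in> S)"

definition compat :: "'a::order set \<Rightarrow> 'a \<Rightarrow> 'a \<Rightarrow> bool" where
  "compat P p q \<longleftrightarrow> (\<exists>r\<in>P. r \<le> p \<and> r \<le> q)"

definition compat_sets :: "'a::order set \<Rightarrow> 'a set \<Rightarrow> 'a set \<Rightarrow> bool" where
  "compat_sets P A B \<longleftrightarrow> (\<exists>a\<in>A. \<exists>b\<in>B. compat P a b)"

definition star :: "'a::order set \<Rightarrow> 'a set \<Rightarrow> 'a \<Rightarrow> 'a set" where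
  "star P C p = {c \<in> C. compat P c p}"

definition star_below :: "'a::order set \<Rightarrow> 'a \<Rightarrow> 'a \<Rightarrow> bool" where
  "star_below P p q \<longleftrightarrow> (\<exists>C. cap P C \<and> (\<forall>c\<in>star P C p. c \<le> q))"

definition regular_poset :: "'a::order set \<Rightarrow> bool" where
  "regular_poset P \<longleftrightarrow>
     (\<forall>D. cap P D \<longrightarrow> (\<exists>C. cap P C \<and> (\<forall>c\<in>C. \<exists>d\<in>D. star_below P c d)))"

definition cluster :: "'a::order set \<Rightarrow> 'a set \<Rightarrow> bool" where
  "cluster P D \<longleftrightarrow> D \<subseteq> P \<and>
     (\<forall>A B. A \<noteq> {} \<and> B \<noteq> {} \<and> A \<union> B = D \<longrightarrow> compat_sets P A B)"

end

theory Submission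
  imports Defs
begin

text \<open>
  Write \<open>K\<close> for the set of minimal selectors inside \<open>Q\<close>.  It is closed, and in a compact Hausdorff
  space a disconnected closed set splits into nonempty parts with disjoint open neighbourhoods
  \<open>U\<close> and \<open>V\<close>.  Every minimal selector either leaves \<open>Q\<close> or belongs to \<open>U\<close> or \<open>V\<close>.  So it contains
  some \<open>d\<close> that is outside \<open>Q\<close>, or whose basic open set lies in \<open>U\<close> or in \<open>V\<close>.  A set that meets
  every minimal selector is a cap, hence these elements \<open>d\<close> form a cap.  By hypothesis some cap \<open>C\<close>
  refines it and has a cluster \<open>Q \<inter> C\<close>.  As \<open>Q\<close> is an up-set, no element of \<open>Q \<inter> C\<close> is below an
  element outside \<open>Q\<close>, so the basic open set of each lies in \<open>U\<close> or in \<open>V\<close>.  Both kinds occur,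
  because both parts of \<open>K\<close> are nonempty and \<open>C\<close> meets every minimal selector.  The cluster
  property now gives compatible elements of different kinds, and a minimal selector through a
  common lower bound would be a point of \<open>U \<inter> V\<close>.

  The link between order and topology is \<open>cap_if_meets_minimal_selectors\<close>, which makes caps the
  covers of the spectrum by subbasic sets; compactness follows because every cap contains a finite
  cap.  In an \<open>\<omega>\<close>-poset any two caps have a common refinement, which makes minimal selectors
  filters and the subbasis a base.  Regularity of the poset gives the Hausdorff property.
\<close>

section \<open>Caps and minimal selectors\<close>

lemma refines_trans: "refines R S \<Longrightarrow> refines S T \<Longrightarrow> refines R T"
  unfolding refines_def by (meson order_trans)

lemma cap_coarsening: "cap P C \<Longrightarrow> refines C D \<Longrightarrow> D \<subseteq> P \<Longrightarrow> cap P D"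
  unfolding cap_def using refines_trans by blast

lemma cap_superset: "cap P C \<Longrightarrow> C \<subseteq> D \<Longrightarrow> D \<subseteq> P \<Longrightarrow> cap P D"
  by (rule cap_coarsening) (auto simp: refines_def)

lemma cap_contains_finite_cap:
  assumes "cap P C"
  obtains F where "finite F" "F \<subseteq> C" "cap P F"
proof -
  obtain B where B: "band P B" "refines B C" and CP: "C \<subseteq> P"
    using assms by (auto simp: cap_def)
  then obtain f where f: "\<And>b. b \<in> B \<Longrightarrow> f b \<in> C \<and> b \<le> f b"
    unfolding refines_def by metis
  have "refines B (f ` B)"
    using f by (auto simp: refines_def)
  moreover have "finite (f ` B)"
    using B by (simp add: band_def)
  moreover have "f ` B \<subseteq> C"
    using f by auto
  ultimately show thesis
    using that[of "f ` B"] B CP by (auto simp: cap_def)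
qed

lemma selector_iff_complement_not_cap:
  assumes "S \<subseteq> P"
  shows "selector P S \<longleftrightarrow> \<not> cap P (P - S)"
proof
  show "selector P S \<Longrightarrow> \<not> cap P (P - S)"
    by (auto simp: selector_def)
  assume non: "\<not> cap P (P - S)"
  show "selector P S"
    unfolding selector_def
  proof (intro conjI allI impI)
    fix C assume C: "cap P C"
    show "S \<inter> C \<noteq> {}"
    proof
      assume "S \<inter> C = {}"
      then have "C \<subseteq> P - S"
        using C by (auto simp: cap_def)
      with C non show False
        using cap_superset by blast
    qed
  qed (fact assms)
qed

text \<open>
  Selectors are the complements of the sets that are not caps, so that a minimal selector is the
  complement of a maximal set that is not a cap.  These exist by Zorn's lemma: a cap inside the
  union of a chain contains a finite cap, which already lies in a member of the chain.
\<close>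

lemma selector_contains_minimal_selector:
  assumes "selector P S"
  obtains T where "minimal_selector P T" "T \<subseteq> S"
proof -
  let ?N = "{A. A \<subseteq> P \<and> P - S \<subseteq> A \<and> \<not> cap P A}"
  have SP: "S \<subseteq> P"
    using assms by (simp add: selector_def)
  have "\<exists>M\<in>?N. \<forall>X\<in>?N. M \<subseteq> X \<longrightarrow> X = M"
  proof (rule subset_Zorn_nonempty)
    have "P - S \<in> ?N"
      using assms selector_iff_complement_not_cap[OF SP] by auto
    then show "?N \<noteq> {}"
      by blast
    fix \<C> assume ne: "\<C> \<noteq> {}" and chain: "subset.chain ?N \<C>"
    then have sub: "\<C> \<subseteq> ?N"
      by (simp add: subset_chain_def)
    have "\<not> cap P (\<Union>\<C>)"
    proof
      assume "cap P (\<Union>\<C>)"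
      then obtain F where F: "finite F" "F \<subseteq> \<Union>\<C>" "cap P F"
        by (rule cap_contains_finite_cap)
      obtain A where "A \<in> \<C>" "F \<subseteq> A"
        using finite_subset_Union_chain[OF F(1,2) ne chain] .
      then show False
        using F(3) sub cap_superset[of P F A] by blast
    qed
    then show "\<Union>\<C> \<in> ?N"
      using ne sub by blast
  qed
  then obtain M where M: "M \<in> ?N" and max: "\<forall>X\<in>?N. M \<subseteq> X \<longrightarrow> X = M"
    by (rule bexE)
  have "minimal_selector P (P - M)"
    unfolding minimal_selector_def
  proof (intro conjI allI impI)
    have "P - (P - M) = M"
      using M by blast
    then show "selector P (P - M)"
      using M selector_iff_complement_not_cap[of "P - M" P] by simp
    fix T assume T: "selector P T \<and> T \<subseteq> P - M"
    then have "P - T \<in> ?N"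
      using M selector_iff_complement_not_cap[of T P] by (auto simp: selector_def)
    moreover have "M \<subseteq> P - T"
      using T M by blast
    ultimately have "P - T = M"
      using bspec[OF max] by simp
    then show "T = P - M"
      using T by (auto simp: selector_def)
  qed
  moreover have "P - M \<subseteq> S"
    using M by blast
  ultimately show thesis
    by (rule that)
qed

text \<open>
  If \<open>D\<close> is not a cap, then its complement is a selector, and a minimal selector inside that
  complement misses \<open>D\<close>.  Thus \<open>D\<close> is a cap as soon as the sets \<^term>\<open>subbasic P d\<close> with \<open>d \<in> D\<close>
  cover the spectrum.
\<close>

lemma cap_if_meets_minimal_selectors:
  assumes "D \<subseteq> P" and "\<And>S. minimal_selector P S \<Longrightarrow> S \<inter> D \<noteq> {}"
  shows "cap P D"
proof (rule ccontr)
  assume "\<not> cap P D"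
  then have "selector P (P - D)"
    using assms(1) by (simp add: selector_iff_complement_not_cap double_diff)
  then obtain S where "minimal_selector P S" "S \<subseteq> P - D"
    by (rule selector_contains_minimal_selector)
  then show False
    using assms(2) by blast
qed

lemma minimal_selector_meets_cap: "minimal_selector P S \<Longrightarrow> cap P C \<Longrightarrow> S \<inter> C \<noteq> {}"
  by (simp add: minimal_selector_def selector_def)

lemma minimal_selector_subset: "minimal_selector P S \<Longrightarrow> S \<subseteq> P"
  by (simp add: minimal_selector_def selector_def)

lemma minimal_selector_private_cap:
  assumes "minimal_selector P S" and "s \<in> S"
  obtains C where "cap P C" "S \<inter> C = {s}"
proof -
  have "\<not> selector P (S - {s})"
    using assms unfolding minimal_selector_def by blast
  then obtain C where C: "cap P C" "(S - {s}) \<inter> C = {}"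
    using minimal_selector_subset[OF assms(1)] unfolding selector_def by blast
  then have "S \<inter> C = {s}"
    using minimal_selector_meets_cap[OF assms(1)] by blast
  with C show thesis
    using that by blast
qed

text \<open>
  In a cap that meets the selector only in \<open>s\<close>, replacing \<open>s\<close> by the larger \<open>p\<close> gives a coarser
  set, hence again a cap, which the selector can only meet in \<open>p\<close>.
\<close>

lemma minimal_selector_upward_closed:
  assumes S: "minimal_selector P S" and "s \<in> S" "s \<le> p" "p \<in> P"
  shows "p \<in> S"
proof -
  obtain C where C: "cap P C" "S \<inter> C = {s}"
    using S \<open>s \<in> S\<close> by (rule minimal_selector_private_cap)
  have "cap P (insert p (C - {s}))"
  proof (rule cap_coarsening[OF C(1)])
    show "refines C (insert p (C - {s}))"
      using \<open>s \<le> p\<close> by (auto simp: refines_def)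
    show "insert p (C - {s}) \<subseteq> P"
      using C(1) \<open>p \<in> P\<close> by (auto simp: cap_def)
  qed
  then show ?thesis
    using minimal_selector_meets_cap[OF S] C(2) by blast
qed

section \<open>Common refinements of caps\<close>

lemma omega_poset_finite_card_le:
  assumes "omega_poset P"
  shows "finite {p \<in> P. card (principal_filter P p) \<le> n}"
proof (rule finite_imageD)
  have "principal_filter P ` {p \<in> P. card (principal_filter P p) \<le> n}
      \<subseteq> (\<Union>k\<le>n. {F \<in> principal_filter P ` P. card F = k})"
    by auto
  then show "finite (principal_filter P ` {p \<in> P. card (principal_filter P p) \<le> n})"
    by (rule finite_subset) (use assms in \<open>auto simp: omega_poset_def\<close>)
  show "inj_on (principal_filter P) {p \<in> P. card (principal_filter P p) \<le> n}"
    by (rule inj_onI) (auto simp: principal_filter_def set_eq_iff intro!: antisym)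
qed

text \<open>
  The maximal elements outside \<open>F\<close> dominate everything outside \<open>F\<close>, and there are finitely many of
  them because their principal filters have at most \<open>card F + 1\<close> elements.  To be comparable also
  with the elements of \<open>F\<close>, a band needs in addition, for each of them, one element below it that is
  either outside \<open>F\<close> or minimal in the whole poset; only the latter can be above an element of \<open>F\<close>.
\<close>

lemma omega_poset_band_below_up_set:
  assumes P: "omega_poset P" and F: "finite F" "up_set P F"
  obtains E where "band P E" "\<And>e f. e \<in> E \<Longrightarrow> f \<in> F \<Longrightarrow> f \<le> e \<Longrightarrow> e = f"
proof -
  have FP: "F \<subseteq> P" and up: "\<And>f p. f \<in> F \<Longrightarrow> p \<in> P \<Longrightarrow> f \<le> p \<Longrightarrow> p \<in> F"
    using F by (auto simp: up_set_def)
  define M where "M = {m \<in> P - F. \<forall>p\<in>P - F. m \<le> p \<longrightarrow> p = m}"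
  have "M \<subseteq> {p \<in> P. card (principal_filter P p) \<le> Suc (card F)}"
  proof
    fix m assume m: "m \<in> M"
    then have "principal_filter P m \<subseteq> insert m F"
      by (auto simp: M_def principal_filter_def)
    then have "card (principal_filter P m) \<le> card (insert m F)"
      using F by (intro card_mono) auto
    then show "m \<in> {p \<in> P. card (principal_filter P p) \<le> Suc (card F)}"
      using m F by (auto simp: M_def)
  qed
  then have finM: "finite M"
    by (rule finite_subset) (rule omega_poset_finite_card_le[OF P])
  have below_M: "\<exists>m\<in>M. p \<le> m" if p: "p \<in> P - F" for p
  proof -
    have "finite (principal_filter P p - F)"
      using P p by (auto simp: omega_poset_def)
    moreover have "p \<in> principal_filter P p - F"
      using p by (auto simp: principal_filter_def)
    ultimately obtain m where "m \<in> principal_filter P p - F"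
      and "\<forall>q\<in>principal_filter P p - F. m \<le> q \<longrightarrow> m = q"
      using finite_has_maximal2[of "principal_filter P p - F" p] by blast
    then have "m \<in> M" "p \<le> m"
      by (auto simp: M_def principal_filter_def)
    then show ?thesis
      by blast
  qed
  have "\<exists>g\<in>P. g \<le> f \<and> (g \<notin> F \<or> (\<forall>p\<in>P. p \<le> g \<longrightarrow> p = g))" if f: "f \<in> F" for f
  proof (cases "\<exists>g\<in>P - F. g \<le> f")
    case False
    then have "finite {p \<in> P. p \<le> f}"
      using finite_subset[of "{p \<in> P. p \<le> f}" F] F by blast
    moreover have "f \<in> {p \<in> P. p \<le> f}"
      using f FP by blast
    ultimately obtain g where "g \<in> {p \<in> P. p \<le> f}" "\<forall>p\<in>{p \<in> P. p \<le> f}. p \<le> g \<longrightarrow> g = p"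
      using finite_has_minimal2[of "{p \<in> P. p \<le> f}" f] by blast
    then show ?thesis
      using order_trans by blast
  qed blast
  then obtain g where g: "\<And>f. f \<in> F \<Longrightarrow> g f \<in> P \<and> g f \<le> f"
    and g_min: "\<And>f. f \<in> F \<Longrightarrow> g f \<notin> F \<or> (\<forall>p\<in>P. p \<le> g f \<longrightarrow> p = g f)"
    by metis
  show thesis
  proof (rule that)
    show "band P (M \<union> g ` F)"
      unfolding band_def
    proof (intro conjI ballI)
      show "finite (M \<union> g ` F)"
        using finM F by simp
      show "M \<union> g ` F \<subseteq> P"
        using g by (auto simp: M_def)
      fix p assume "p \<in> P"
      then show "\<exists>b\<in>M \<union> g ` F. p \<le> b \<or> b \<le> p"
        using below_M[of p] g[of p] by blast
    qed
    fix e f assume e: "e \<in> M \<union> g ` F" and f: "f \<in> F" "f \<le> e"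
    moreover have "e \<in> P"
      using e g by (auto simp: M_def)
    ultimately have "e \<in> F"
      using up by blast
    then have "e \<in> g ` F"
      using e by (auto simp: M_def)
    then show "e = f"
      using g_min f FP \<open>e \<in> F\<close> by blast
  qed
qed

text \<open>
  Apply the previous lemma to the up-set generated by bands that refine \<open>C\<close> and \<open>D\<close>.  Each element
  of the new band is comparable to some \<open>x\<close> in either of these two bands, and where it is above \<open>x\<close>
  it is equal to \<open>x\<close>.
\<close>

lemma omega_poset_common_refinement:
  assumes P: "omega_poset P" and "cap P C" "cap P D"
  obtains E where "cap P E" "refines E C" "refines E D"
proof -
  obtain A B where A: "band P A" "refines A C" and B: "band P B" "refines B D"
    using assms by (auto simp: cap_def)
  let ?F = "\<Union>x\<in>A \<union> B. principal_filter P x"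
  have "finite ?F"
    using A B P by (auto simp: band_def omega_poset_def)
  moreover have "up_set P ?F"
    by (auto simp: up_set_def principal_filter_def intro: order_trans)
  ultimately obtain E where E: "band P E"
    and low: "\<And>e f. e \<in> E \<Longrightarrow> f \<in> ?F \<Longrightarrow> f \<le> e \<Longrightarrow> e = f"
    using omega_poset_band_below_up_set[OF P] by metis
  have ref: "refines E X" if X: "band P X" "X \<subseteq> A \<union> B" for X
    unfolding refines_def
  proof
    fix e assume e: "e \<in> E"
    then obtain x where x: "x \<in> X" "e \<le> x \<or> x \<le> e"
      using E X unfolding band_def by blast
    have "x \<in> ?F"
      using x X by (auto simp: band_def principal_filter_def)
    then have "e \<le> x"
      using low[OF e] x by blast
    then show "\<exists>t\<in>X. e \<le> t"
      using x by blast
  qed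
  show thesis
  proof (rule that)
    show "cap P E"
      using E by (auto simp: cap_def band_def refines_def)
    show "refines E C" "refines E D"
      using ref A B refines_trans by blast+
  qed
qed

lemma omega_poset_cap_exists:
  assumes "omega_poset P"
  obtains C where "cap P C"
proof -
  obtain E where "band P E"
    using omega_poset_band_below_up_set[OF assms, of "{}"] by (auto simp: up_set_def)
  then have "cap P E"
    by (auto simp: cap_def band_def refines_def)
  then show thesis
    by (rule that)
qed

text \<open>
  Take caps that meet the selector only in \<open>p\<close> and only in \<open>q\<close>.  An element of the selector in a
  common refinement lies below elements of these two caps, which belong to the selector and so can
  only be \<open>p\<close> and \<open>q\<close>.
\<close>

lemma minimal_selector_directed:
  assumes P: "omega_poset P" and S: "minimal_selector P S" and "p \<in> S" "q \<in> S"
  obtains r where "r \<in> S" "r \<le> p" "r \<le> q"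
proof -
  obtain C where C: "cap P C" "S \<inter> C = {p}"
    using S \<open>p \<in> S\<close> by (rule minimal_selector_private_cap)
  obtain D where D: "cap P D" "S \<inter> D = {q}"
    using S \<open>q \<in> S\<close> by (rule minimal_selector_private_cap)
  obtain E where E: "cap P E" "refines E C" "refines E D"
    using P C(1) D(1) by (rule omega_poset_common_refinement)
  obtain r where r: "r \<in> S" "r \<in> E"
    using minimal_selector_meets_cap[OF S E(1)] by blast
  obtain c d where cd: "c \<in> C" "r \<le> c" "d \<in> D" "r \<le> d"
    using r E by (meson refines_def)
  have "c \<in> S" "d \<in> S"
    using minimal_selector_upward_closed[OF S r(1)] cd C(1) D(1) by (auto simp: cap_def)
  then have "c = p" "d = q"
    using C D cd by blast+
  with r cd show thesis
    using that by blast
qed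

lemma minimal_selector_compat:
  assumes P: "omega_poset P" and S: "minimal_selector P S" and "p \<in> S" "q \<in> S"
  shows "compat P p q"
proof -
  obtain r where "r \<in> S" "r \<le> p" "r \<le> q"
    using minimal_selector_directed[OF assms] .
  then show ?thesis
    using minimal_selector_subset[OF S] by (auto simp: compat_def)
qed

section \<open>Topology of the spectrum\<close>

lemma mem_spectrum_set: "S \<in> spectrum_set P \<longleftrightarrow> minimal_selector P S"
  by (simp add: spectrum_set_def)

lemma openin_subbasic: "p \<in> P \<Longrightarrow> openin (spectrum P) (subbasic P p)"
  unfolding spectrum_def by (rule topology_generated_by_Basis) simp

lemma subbasic_antimono: "d \<le> e \<Longrightarrow> e \<in> P \<Longrightarrow> subbasic P d \<subseteq> subbasic P e"
  by (auto simp: subbasic_def mem_spectrum_set intro: minimal_selector_upward_closed)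

text \<open>
  Since minimal selectors are directed, the sets \<^term>\<open>subbasic P p\<close> form a base of the topology.
\<close>

lemma openin_spectrum_subbasic_nhd:
  assumes P: "omega_poset P" and "openin (spectrum P) U" and "S \<in> U"
  obtains d where "d \<in> S" "subbasic P d \<subseteq> U"
proof -
  have "\<exists>d\<in>S. subbasic P d \<subseteq> U"
    if "generate_topology_on (insert (spectrum_set P) (subbasic P ` P)) U"
      and "minimal_selector P S" and "S \<in> U" for U
    using that
  proof induction
    case (Int U V)
    then obtain p q where pq: "p \<in> S" "subbasic P p \<subseteq> U" "q \<in> S" "subbasic P q \<subseteq> V"
      by blast
    obtain r where r: "r \<in> S" "r \<le> p" "r \<le> q"
      using minimal_selector_directed[OF P \<open>minimal_selector P S\<close> pq(1,3)] .
    have "subbasic P r \<subseteq> subbasic P p \<inter> subbasic P q"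
      using r pq minimal_selector_subset[OF \<open>minimal_selector P S\<close>] subbasic_antimono by blast
    then show ?case
      using r pq by blast
  next
    case (UN K)
    then show ?case
      by (meson UnionE Union_upper order_trans)
  next
    case (Basis U)
    \<comment> \<open>A cap is needed only for the whole space as a generator: it makes \<open>S\<close> nonempty.\<close>
    obtain C where "cap P C"
      using omega_poset_cap_exists[OF P] .
    then obtain s where "s \<in> S"
      using minimal_selector_meets_cap Basis.prems(1) by blast
    with Basis show ?case
      by (auto simp: subbasic_def)
  qed simp
  moreover have "minimal_selector P S"
    using openin_subset[OF assms(2)] \<open>S \<in> U\<close> by (auto simp: topspace_spectrum mem_spectrum_set)
  ultimately show thesis
    using that assms by (auto simp: spectrum_def openin_topology_generated_by_iff)
qed

text \<open>
  For an open cover, the elements \<open>d\<close> for which \<^term>\<open>subbasic P d\<close> lies in a member of the cover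
  form a cap, and a finite cap among them gives a finite subcover.
\<close>

lemma compact_space_spectrum:
  assumes P: "omega_poset P"
  shows "compact_space (spectrum P)"
  unfolding compact_space
proof (intro allI impI, elim conjE)
  fix \<U> assume op: "\<forall>U\<in>\<U>. openin (spectrum P) U" and cov: "\<Union>\<U> = topspace (spectrum P)"
  let ?D = "{d \<in> P. \<exists>U\<in>\<U>. subbasic P d \<subseteq> U}"
  have "cap P ?D"
  proof (rule cap_if_meets_minimal_selectors)
    fix S assume S: "minimal_selector P S"
    then obtain U where U: "U \<in> \<U>" "S \<in> U"
      using cov mem_spectrum_set[of S P] by (auto simp: topspace_spectrum)
    then obtain d where "d \<in> S" "subbasic P d \<subseteq> U"
      using openin_spectrum_subbasic_nhd[OF P] op by metis
    then show "S \<inter> ?D \<noteq> {}"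
      using U minimal_selector_subset[OF S] by blast
  qed auto
  then obtain F where F: "finite F" "F \<subseteq> ?D" "cap P F"
    by (rule cap_contains_finite_cap)
  have "\<forall>d\<in>F. \<exists>U. U \<in> \<U> \<and> subbasic P d \<subseteq> U"
    using F(2) by blast
  then obtain u where u: "\<And>d. d \<in> F \<Longrightarrow> u d \<in> \<U> \<and> subbasic P d \<subseteq> u d"
    by (auto dest!: bchoice)
  have "spectrum_set P \<subseteq> \<Union>(u ` F)"
  proof
    fix S assume S: "S \<in> spectrum_set P"
    then obtain d where "d \<in> S" "d \<in> F"
      using minimal_selector_meets_cap[OF _ F(3)] unfolding mem_spectrum_set by blast
    then show "S \<in> \<Union>(u ` F)"
      using u S by (auto simp: subbasic_def)
  qed
  moreover have "\<Union>(u ` F) \<subseteq> spectrum_set P"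
    using u cov by (auto simp: topspace_spectrum)
  ultimately show "\<exists>\<F>. finite \<F> \<and> \<F> \<subseteq> \<U> \<and> \<Union>\<F> = topspace (spectrum P)"
    using F u by (intro exI[of _ "u ` F"]) (auto simp: topspace_spectrum)
qed

text \<open>
  Let \<open>s\<close> belong to the minimal selector \<open>S\<close> but not to \<open>T\<close>.  Regularity shrinks \<open>s\<close> to some
  \<open>e \<in> S\<close> with a cap whose elements compatible with \<open>e\<close> are all below \<open>s\<close>.  Then \<open>T\<close> meets this
  cap in an element incompatible with \<open>e\<close>, which gives disjoint neighbourhoods.
\<close>

lemma Hausdorff_space_spectrum:
  assumes P: "omega_poset P" and reg: "regular_poset P"
  shows "Hausdorff_space (spectrum P)"
  unfolding Hausdorff_space_def
proof (intro allI impI, elim conjE)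
  fix S T assume "S \<in> topspace (spectrum P)" "T \<in> topspace (spectrum P)" "S \<noteq> T"
  then have S: "minimal_selector P S" and T: "minimal_selector P T" and "\<not> S \<subseteq> T"
    unfolding topspace_spectrum mem_spectrum_set by (auto simp: minimal_selector_def)
  then obtain s where s: "s \<in> S" "s \<notin> T"
    by blast
  have sP: "s \<in> P"
    using s minimal_selector_subset[OF S] by blast
  obtain C where C: "cap P C" "S \<inter> C = {s}"
    using S s(1) by (rule minimal_selector_private_cap)
  obtain E where E: "cap P E" "\<forall>e\<in>E. \<exists>d\<in>C. star_below P e d"
    using reg C(1) unfolding regular_poset_def by blast
  obtain e where e: "e \<in> S" "e \<in> E"
    using minimal_selector_meets_cap[OF S E(1)] by blast
  obtain d where d: "d \<in> C" "star_below P e d"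
    using E e by blast
  obtain D where D: "cap P D" "\<And>c. c \<in> D \<Longrightarrow> compat P c e \<Longrightarrow> c \<le> d"
    using d(2) by (auto simp: star_below_def star_def)
  have "d \<in> S"
  proof -
    obtain c where c: "c \<in> S" "c \<in> D"
      using minimal_selector_meets_cap[OF S D(1)] by blast
    then have "c \<le> d"
      using D(2) minimal_selector_compat[OF P S] e by blast
    then show ?thesis
      using minimal_selector_upward_closed[OF S c(1)] d C by (auto simp: cap_def)
  qed
  then have "d = s"
    using C d by blast
  obtain t where t: "t \<in> T" "t \<in> D"
    using minimal_selector_meets_cap[OF T D(1)] by blast
  have "\<not> t \<le> s"
    using minimal_selector_upward_closed[OF T t(1) _ sP] s by blast
  then have "\<not> compat P t e"
    using D(2) t \<open>d = s\<close> by blast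
  then have "disjnt (subbasic P e) (subbasic P t)"
    using minimal_selector_compat[OF P] by (auto simp: disjnt_def subbasic_def mem_spectrum_set)
  moreover have "S \<in> subbasic P e" "T \<in> subbasic P t"
    using S T e t by (auto simp: subbasic_def mem_spectrum_set)
  moreover have "e \<in> P" "t \<in> P"
    using e t S T minimal_selector_subset by blast+
  ultimately show "\<exists>U V. openin (spectrum P) U \<and> openin (spectrum P) V \<and> S \<in> U \<and> T \<in> V \<and> disjnt U V"
    using openin_subbasic by blast
qed

lemma closedin_minimal_selectors_inside:
  "closedin (spectrum P) {S \<in> spectrum_set P. S \<subseteq> Q}"
proof -
  have "spectrum_set P - {S \<in> spectrum_set P. S \<subseteq> Q} = \<Union>(subbasic P ` (P - Q))"
    using minimal_selector_subset by (fastforce simp: subbasic_def mem_spectrum_set)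
  moreover have "openin (spectrum P) (\<Union>(subbasic P ` (P - Q)))"
    by (auto intro: openin_subbasic)
  ultimately show ?thesis
    by (auto simp: closedin_def topspace_spectrum)
qed

section \<open>Connectedness\<close>

theorem proposition2p49:
  fixes P Q :: "'a::order set"
  assumes "omega_poset P" and "prime_poset P" and "regular_poset P"
    and "up_set P Q" and "selector P Q"
    and "\<forall>D. cap P D \<longrightarrow> (\<exists>C. cap P C \<and> cluster P (Q \<inter> C) \<and> refines C D)"
  shows "connectedin (spectrum P) {S \<in> spectrum_set P. S \<subseteq> Q}"
proof -
  let ?K = "{S \<in> spectrum_set P. S \<subseteq> Q}"
  note P = \<open>omega_poset P\<close>
  have False
    if cl: "closedin (spectrum P) E1" "closedin (spectrum P) E2"
      and cover: "?K \<subseteq> E1 \<union> E2" and disj: "E1 \<inter> E2 \<inter> ?K = {}"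
      and ne: "E1 \<inter> ?K \<noteq> {}" "E2 \<inter> ?K \<noteq> {}" for E1 E2
  proof -
    have "normal_space (spectrum P)"
      using compact_space_spectrum[OF P] Hausdorff_space_spectrum[OF P \<open>regular_poset P\<close>]
        compact_Hausdorff_or_regular_imp_normal_space by blast
    moreover have "closedin (spectrum P) (E1 \<inter> ?K)" "closedin (spectrum P) (E2 \<inter> ?K)"
      using cl closedin_minimal_selectors_inside by blast+
    moreover have "disjnt (E1 \<inter> ?K) (E2 \<inter> ?K)"
      using disj by (auto simp: disjnt_def)
    ultimately have "\<exists>U V. openin (spectrum P) U \<and> openin (spectrum P) V \<and>
        E1 \<inter> ?K \<subseteq> U \<and> E2 \<inter> ?K \<subseteq> V \<and> disjnt U V"
      unfolding normal_space_def by simp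
    then obtain U V where UV: "openin (spectrum P) U" "openin (spectrum P) V"
      "E1 \<inter> ?K \<subseteq> U" "E2 \<inter> ?K \<subseteq> V" "disjnt U V"
      by blast
    \<comment> \<open>The elements outside \<open>Q\<close> take care of the minimal selectors that are not inside \<open>Q\<close>, and no
      element of \<open>Q\<close> is below them.\<close>
    let ?D = "{d \<in> P. d \<notin> Q \<or> subbasic P d \<subseteq> U \<or> subbasic P d \<subseteq> V}"
    have "cap P ?D"
    proof (rule cap_if_meets_minimal_selectors)
      fix S assume S: "minimal_selector P S"
      have "\<exists>d\<in>S. d \<notin> Q \<or> subbasic P d \<subseteq> U \<or> subbasic P d \<subseteq> V"
      proof (cases "S \<subseteq> Q")
        case True
        then have "S \<in> U \<or> S \<in> V"
          using S cover UV(3,4) mem_spectrum_set by blast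
        then show ?thesis
          using openin_spectrum_subbasic_nhd[OF P] UV(1,2) by metis
      qed blast
      then show "S \<inter> ?D \<noteq> {}"
        using minimal_selector_subset[OF S] by blast
    qed blast
    then obtain C where C: "cap P C" "cluster P (Q \<inter> C)" "refines C ?D"
      using assms(6) by blast
    let ?A = "{c \<in> Q \<inter> C. subbasic P c \<subseteq> U}" and ?B = "{c \<in> Q \<inter> C. subbasic P c \<subseteq> V}"
    have "c \<in> ?A \<union> ?B" if c: "c \<in> Q \<inter> C" for c
    proof -
      obtain d where d: "d \<in> ?D" "c \<le> d"
        using C(3) c by (auto simp: refines_def)
      then have "d \<in> Q"
        using \<open>up_set P Q\<close> c by (auto simp: up_set_def)
      then show ?thesis
        using d c subbasic_antimono[of c d P] by blast
    qed
    then have union: "?A \<union> ?B = Q \<inter> C"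
      by blast
    have meets: "\<exists>c\<in>Q \<inter> C. S \<in> subbasic P c" if "S \<in> ?K" for S
      using that minimal_selector_meets_cap[OF _ C(1)] by (auto simp: subbasic_def mem_spectrum_set)
    \<comment> \<open>If \<open>c\<close> belongs to a point \<open>S\<close> of \<open>E1\<close>, then \<open>S\<close> shows that the basic open set of \<open>c\<close> is not
      contained in \<open>V\<close>; likewise for \<open>E2\<close> and \<open>U\<close>.\<close>
    have "?A \<noteq> {}"
    proof -
      obtain S where S: "S \<in> E1 \<inter> ?K"
        using ne by blast
      then obtain c where "c \<in> Q \<inter> C" "S \<in> subbasic P c"
        using meets by blast
      moreover have "S \<notin> V"
        using S UV(3,5) by (auto simp: disjnt_iff)
      ultimately have "c \<in> ?A"
        using union by blast
      then show ?thesis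
        by blast
    qed
    moreover have "?B \<noteq> {}"
    proof -
      obtain S where S: "S \<in> E2 \<inter> ?K"
        using ne by blast
      then obtain c where "c \<in> Q \<inter> C" "S \<in> subbasic P c"
        using meets by blast
      moreover have "S \<notin> U"
        using S UV(4,5) by (auto simp: disjnt_iff)
      ultimately have "c \<in> ?B"
        using union by blast
      then show ?thesis
        by blast
    qed
    ultimately have "compat_sets P ?A ?B"
      using C(2) union unfolding cluster_def by simp
    then obtain a b r where ab: "a \<in> ?A" "b \<in> ?B" and r: "r \<in> P" "r \<le> a" "r \<le> b"
      unfolding compat_sets_def compat_def by blast
    \<comment> \<open>Primeness turns compatibility in \<open>P\<close> into a common point of two subbasic sets.\<close>
    obtain S where S: "minimal_selector P S" "r \<in> S"
      using \<open>prime_poset P\<close> r(1) by (auto simp: prime_poset_def)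
    have "a \<in> P" "b \<in> P"
      using ab C(1) by (auto simp: cap_def)
    then have "S \<in> subbasic P a \<inter> subbasic P b"
      using S r minimal_selector_upward_closed[OF S] by (auto simp: subbasic_def mem_spectrum_set)
    then show False
      using ab UV(5) by (auto simp: disjnt_iff)
  qed
  then show ?thesis
    unfolding connectedin_closedin topspace_spectrum by blast
qed

end
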